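(* Let $n\ge1$, let $K_n$ be the Kasteleyn matrix of the graph $G_n$, let $\mathbf b=(2n,2n+1-[n]_2)$, and for $0\le j\le 2n$ let $g_n^{\mathbf b}(j)=|K_n^{-1}((j,j),\mathbf b)|$. Then $$\sum_{j=0}^{2n}g_n^{\mathbf b}(j)=\begin{cases}n+1 & n\text{ even},\\ n+\frac12 & n\text{ odd}.\end{cases}$$
   Context: Notation: $[x]_2\in\{0,1\}$ is $x \bmod 2$. Graph: $G_n=(\mathtt V_n,\mathtt E_n)$, where $\mathtt V_n=\{(x_1,x_2)\in\mathbb Z^2: 0\le x_1\le 2n,\ x_1\le x_2\le 2n+1\}$, with the vertex $(2n,2n+1)$ removed when $n$ is odd, and $\mathtt E_n$ consists of - the edges $\{(x_1,x_2),(x_1+1,x_2)\}$ with $0\le x_1\le 2n-1$, $x_1\le x_2\le 2n+1$, $[x_1+x_2]_2=1$; - the edges $\{(x_1,x_2),(x_1,x_2+1)\}$ with $0\le x_1\le 2n-[n]_2$, $x_1\le x_2\le 2n$; - the edges $\{(x_1,x_1),(x_1+1,x_1+1)\}$ with $0\le x_1\le 2n-1$. Kasteleyn matrix: $K_n=(K_n(x,y))_{x,y\in\mathtt V_n}$ with $K_n(x,y)=k_n(x,y)-k_n(y,x)$, where $k_n((x_1,x_2),(y_1,y_2))=1$ if [$[x_1+x_2]_2=0$, $x_2=y_2$, $x_1-y_1=1$], or [$[x_1+x_2]_2=0$, $|y_2-x_2|=1$, $x_1=y_1$], or [$x_1=x_2$ and $y_1=y_2=x_1-1$], and $k_n=0$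 otherwise. $|\mathrm{Pf}\,K_n|$ is the number of perfect matchings of $G_n$, which is nonzero. For $0\le j\le 2n-1$, $g_n^{\mathbf b}(j)$ equals the number of perfect matchings of $G_n$ with the vertices $(j,j),\mathbf b$ removed, divided by the number of perfect matchings of $G_n$. *)

theory Defs
  imports Complex_Main
begin

type_synonym vertex = "int \<times> int"

text \<open>A matrix whose rows and columns are indexed by a finite set \<open>I\<close> is a function on pairs of
  indices. Only its entries on \<open>I \<times> I\<close> matter; the entries of an inverse outside \<open>I \<times> I\<close> are fixed
  to be 0, which makes the inverse unique as a function. For a singular matrix \<open>inverse_on\<close> is
  unspecified.\<close>

definition is_inverse_on :: "'a set \<Rightarrow> ('a \<Rightarrow> 'a \<Rightarrow> real) \<Rightarrow> ('a \<Rightarrow> 'a \<Rightarrow> real) \<Rightarrow> bool" where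
  "is_inverse_on I A B \<longleftrightarrow>
     (\<forall>x\<in>I. \<forall>y\<in>I. (\<Sum>z\<in>I. A x z * B z y) = (if x = y then 1 else 0)) \<and>
     (\<forall>x\<in>I. \<forall>y\<in>I. (\<Sum>z\<in>I. B x z * A z y) = (if x = y then 1 else 0)) \<and>
     (\<forall>x y. x \<notin> I \<or> y \<notin> I \<longrightarrow> B x y = 0)"

definition inverse_on :: "'a set \<Rightarrow> ('a \<Rightarrow> 'a \<Rightarrow> real) \<Rightarrow> 'a \<Rightarrow> 'a \<Rightarrow> real" where
  "inverse_on I A = (THE B. is_inverse_on I A B)"

lemma is_inverse_on_unique:
  assumes "finite I" and B: "is_inverse_on I A B" and C: "is_inverse_on I A C"
  shows "B = C"
proof (intro ext)
  fix x y
  show "B x y = C x y"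
  proof (cases "x \<in> I \<and> y \<in> I")
    case False
    then show ?thesis using B C by (simp add: is_inverse_on_def)
  next
    case True
    have "B x y = (\<Sum>z\<in>I. B x z * (if z = y then 1 else 0))"
      using True \<open>finite I\<close> by (simp add: if_distrib sum.delta cong: if_cong)
    also have "\<dots> = (\<Sum>z\<in>I. B x z * (\<Sum>w\<in>I. A z w * C w y))"
      using C True by (intro sum.cong) (auto simp: is_inverse_on_def)
    also have "\<dots> = (\<Sum>w\<in>I. (\<Sum>z\<in>I. B x z * A z w) * C w y)"
      by (simp only: sum_distrib_left sum_distrib_right mult.assoc) (rule sum.swap)
    also have "\<dots> = (\<Sum>w\<in>I. (if x = w then 1 else 0) * C w y)"
      using B True by (intro sum.cong) (auto simp: is_inverse_on_def)
    also have "\<dots> = C x y"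
      using True \<open>finite I\<close> by (simp add: if_distrib[of "\<lambda>t. t * _"] sum.delta cong: if_cong)
    finally show ?thesis .
  qed
qed

lemma inverse_on_eqI:
  assumes "finite I" and "is_inverse_on I A B"
  shows "inverse_on I A = B"
  unfolding inverse_on_def
  using assms by (blast intro: the_equality is_inverse_on_unique)

definition G_verts :: "nat \<Rightarrow> vertex set" where
  "G_verts n = {(x1, x2). 0 \<le> x1 \<and> x1 \<le> 2 * int n \<and> x1 \<le> x2 \<and> x2 \<le> 2 * int n + 1}
         - (if odd n then {(2 * int n, 2 * int n + 1)} else {})"

definition G_edges :: "nat \<Rightarrow> vertex set set" where
  "G_edges n =
     {{(x1, x2), (x1 + 1, x2)} | x1 x2.
        0 \<le> x1 \<and> x1 \<le> 2 * int n - 1 \<and> x1 \<le> x2 \<and> x2 \<le> 2 * int n + 1 \<and> (x1 + x2) mod 2 = 1} \<union>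
     {{(x1, x2), (x1, x2 + 1)} | x1 x2.
        0 \<le> x1 \<and> x1 \<le> 2 * int n - int n mod 2 \<and> x1 \<le> x2 \<and> x2 \<le> 2 * int n} \<union>
     {{(x1, x1), (x1 + 1, x1 + 1)} | x1. 0 \<le> x1 \<and> x1 \<le> 2 * int n - 1}"

text \<open>The entries depend on \<open>n\<close> only through the index set, so \<open>kast_entry\<close> and \<open>kast\<close> carry no \<open>n\<close>; the
  matrix \<open>K\<^sub>n\<close> is the restriction of \<open>kast\<close> to \<open>G_verts n \<times> G_verts n\<close>.\<close>

fun kast_entry :: "vertex \<Rightarrow> vertex \<Rightarrow> real" where
  "kast_entry (x1, x2) (y1, y2) =
     (if ((x1 + x2) mod 2 = 0 \<and> x2 = y2 \<and> x1 - y1 = 1) \<or>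
         ((x1 + x2) mod 2 = 0 \<and> \<bar>y2 - x2\<bar> = 1 \<and> x1 = y1) \<or>
         (x1 = x2 \<and> y1 = x1 - 1 \<and> y2 = x1 - 1)
      then 1 else 0)"

definition kast :: "vertex \<Rightarrow> vertex \<Rightarrow> real" where
  "kast x y = kast_entry x y - kast_entry y x"

lemma kast_nonzero_iff_edge:
  assumes "x \<in> G_verts n" and "y \<in> G_verts n"
  shows "kast x y \<noteq> 0 \<longleftrightarrow> {x, y} \<in> G_edges n"
proof -
  obtain x1 x2 y1 y2 where xy: "x = (x1, x2)" "y = (y1, y2)" by (cases x, cases y)
  have V: "0 \<le> a" "a \<le> 2 * int n" "a \<le> c" "c \<le> 2 * int n + 1"
      "int n mod 2 = 1 \<Longrightarrow> a = 2 * int n \<Longrightarrow> c \<noteq> 2 * int n + 1"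
    if "(a, c) \<in> G_verts n" for a c
  proof -
    have "odd n" if "int n mod 2 = 1" using that by presburger
    with that show "0 \<le> a" "a \<le> 2 * int n" "a \<le> c" "c \<le> 2 * int n + 1"
        "int n mod 2 = 1 \<Longrightarrow> a = 2 * int n \<Longrightarrow> c \<noteq> 2 * int n + 1"
      by (auto simp: G_verts_def)
  qed
  define P1 P2 P3 where
    "P1 = (\<lambda>u1 u2. 0 \<le> u1 \<and> u1 \<le> 2 * int n - 1 \<and> u1 \<le> u2 \<and> u2 \<le> 2 * int n + 1 \<and> (u1 + u2) mod 2 = 1)" and
    "P2 = (\<lambda>u1 u2. 0 \<le> u1 \<and> u1 \<le> 2 * int n - int n mod 2 \<and> u1 \<le> u2 \<and> u2 \<le> 2 * int n)" and
    "P3 = (\<lambda>u1. 0 \<le> u1 \<and> u1 \<le> 2 * int n - 1)"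
  have E0: "G_edges n = {{(u1, u2), (u1 + 1, u2)} | u1 u2. P1 u1 u2} \<union>
      {{(u1, u2), (u1, u2 + 1)} | u1 u2. P2 u1 u2} \<union> {{(u1, u1), (u1 + 1, u1 + 1)} | u1. P3 u1}"
    unfolding G_edges_def P1_def P2_def P3_def ..
  have E1: "{x, y} \<in> {{(u1, u2), (u1 + 1, u2)} | u1 u2. P u1 u2} \<longleftrightarrow>
      P x1 x2 \<and> y1 = x1 + 1 \<and> y2 = x2 \<or> P y1 y2 \<and> x1 = y1 + 1 \<and> x2 = y2" for P
    unfolding xy mem_Collect_eq doubleton_eq_iff prod.inject by blast
  have E2: "{x, y} \<in> {{(u1, u2), (u1, u2 + 1)} | u1 u2. P u1 u2} \<longleftrightarrow>
      P x1 x2 \<and> y1 = x1 \<and> y2 = x2 + 1 \<or> P y1 y2 \<and> x1 = y1 \<and> x2 = y2 + 1" for P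
    unfolding xy mem_Collect_eq doubleton_eq_iff prod.inject by blast
  have E3: "{x, y} \<in> {{(u1, u1), (u1 + 1, u1 + 1)} | u1. P u1} \<longleftrightarrow>
      P x1 \<and> x2 = x1 \<and> y1 = x1 + 1 \<and> y2 = x1 + 1 \<or> P y1 \<and> y2 = y1 \<and> x1 = y1 + 1 \<and> x2 = y1 + 1" for P
    unfolding xy mem_Collect_eq doubleton_eq_iff prod.inject by blast
  have aux: "(if P then 1 else 0 :: real) - (if Q then 1 else 0) \<noteq> 0 \<longleftrightarrow> P \<noteq> Q" for P Q :: bool
    by simp
  have K: "kast x y \<noteq> 0 \<longleftrightarrow>
      ((x1 + x2) mod 2 = 0 \<and> x2 = y2 \<and> x1 - y1 = 1 \<or>
       (x1 + x2) mod 2 = 0 \<and> \<bar>y2 - x2\<bar> = 1 \<and> x1 = y1 \<or>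
       x1 = x2 \<and> y1 = x1 - 1 \<and> y2 = x1 - 1) \<noteq>
      ((y1 + y2) mod 2 = 0 \<and> y2 = x2 \<and> y1 - x1 = 1 \<or>
       (y1 + y2) mod 2 = 0 \<and> \<bar>x2 - y2\<bar> = 1 \<and> y1 = x1 \<or>
       y1 = y2 \<and> x1 = y1 - 1 \<and> x2 = y1 - 1)"
    unfolding kast_def xy kast_entry.simps by (rule aux)
  note X = V[of x1 x2, folded xy, OF assms(1)] and Y = V[of y1 y2, folded xy, OF assms(2)]
  have abs1: "\<bar>p - q\<bar> = 1 \<longleftrightarrow> p = q + 1 \<or> q = p + 1" for p q :: int
    by auto
  consider "x1 = y1" "y2 = x2 + 1" | "x1 = y1" "x2 = y2 + 1"
    | "x2 = y2" "y1 = x1 + 1" | "x2 = y2" "x1 = y1 + 1"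
    | "y1 = x1 + 1" "y2 = x2 + 1" | "x1 = y1 + 1" "x2 = y2 + 1"
    | "\<not> (x1 = y1 \<and> \<bar>y2 - x2\<bar> = 1)" "\<not> (x2 = y2 \<and> \<bar>y1 - x1\<bar> = 1)"
      "\<not> (y1 = x1 + 1 \<and> y2 = x2 + 1)" "\<not> (x1 = y1 + 1 \<and> x2 = y2 + 1)"
    using abs1[of y2 x2] abs1[of y1 x1] by blast
  then show ?thesis
  proof cases
    case 1
    have "(x1 + x2) mod 2 = 0 \<longleftrightarrow> (y1 + y2) mod 2 \<noteq> 0" using 1 by presburger
    then have "kast x y \<noteq> 0" unfolding K using 1 by auto
    moreover have "P2 x1 x2" using 1 X Y unfolding P2_def by linarith
    ultimately show ?thesis unfolding E0 Un_iff E2 using 1 by simp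
  next
    case 2
    have "(x1 + x2) mod 2 = 0 \<longleftrightarrow> (y1 + y2) mod 2 \<noteq> 0" using 2 by presburger
    then have "kast x y \<noteq> 0" unfolding K using 2 by auto
    moreover have "P2 y1 y2" using 2 X Y unfolding P2_def by linarith
    ultimately show ?thesis unfolding E0 Un_iff E2 using 2 by simp
  next
    case 3
    have "(y1 + y2) mod 2 = 0 \<longleftrightarrow> (x1 + x2) mod 2 = 1" using 3 by presburger
    moreover have "P1 x1 x2 \<longleftrightarrow> (x1 + x2) mod 2 = 1" using 3 X(1-4) Y(1-4) unfolding P1_def by auto
    ultimately show ?thesis unfolding K E0 Un_iff E1 E2 E3 using 3 by auto
  next
    case 4
    have "(x1 + x2) mod 2 = 0 \<longleftrightarrow> (y1 + y2) mod 2 = 1" using 4 by presburger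
    moreover have "P1 y1 y2 \<longleftrightarrow> (y1 + y2) mod 2 = 1" using 4 X(1-4) Y(1-4) unfolding P1_def by auto
    ultimately show ?thesis unfolding K E0 Un_iff E1 E2 E3 using 4 by auto
  next
    case 5
    have "P3 x1" using 5 X(1-4) Y(1-4) unfolding P3_def by linarith
    then show ?thesis unfolding K E0 Un_iff E1 E2 E3 using 5 by auto
  next
    case 6
    have "P3 y1" using 6 X(1-4) Y(1-4) unfolding P3_def by linarith
    then show ?thesis unfolding K E0 Un_iff E1 E2 E3 using 6 by auto
  next
    case 7
    have "\<not> (x2 = y2 \<and> x1 - y1 = 1)" "\<not> (y2 = x2 \<and> y1 - x1 = 1)"
      "\<not> (y1 = x1 + 1 \<and> y2 = x2)" "\<not> (x1 = y1 + 1 \<and> x2 = y2)"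
      using 7(2) by auto
    moreover have "\<not> (\<bar>y2 - x2\<bar> = 1 \<and> x1 = y1)" "\<not> (\<bar>x2 - y2\<bar> = 1 \<and> y1 = x1)"
      "\<not> (y1 = x1 \<and> y2 = x2 + 1)" "\<not> (x1 = y1 \<and> x2 = y2 + 1)"
      using 7(1) by auto
    moreover have "\<not> (y1 = y2 \<and> x1 = y1 - 1 \<and> x2 = y1 - 1)"
      "\<not> (x2 = x1 \<and> y1 = x1 + 1 \<and> y2 = x1 + 1)"
      using 7(3) by auto
    moreover have "\<not> (x1 = x2 \<and> y1 = x1 - 1 \<and> y2 = x1 - 1)"
      "\<not> (y2 = y1 \<and> x1 = y1 + 1 \<and> x2 = y1 + 1)"
      using 7(4) by auto
    ultimately have "\<not> kast x y \<noteq> 0" "{x, y} \<notin> G_edges n"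
      unfolding K E0 Un_iff E1 E2 E3 by blast+
    then show ?thesis by blast
  qed
qed

definition b_vertex :: "nat \<Rightarrow> vertex" where
  "b_vertex n = (2 * int n, 2 * int n + 1 - int n mod 2)"

definition g_b :: "nat \<Rightarrow> nat \<Rightarrow> real" where
  "g_b n j = \<bar>inverse_on (G_verts n) kast (int j, int j) (b_vertex n)\<bar>"

end

theory Submission
  imports Defs "Jordan_Normal_Form.Determinant"
begin

text \<open>
  Away from the diagonal the Kasteleyn matrix couples only vertices of opposite parity, so a vector
  \<open>v\<close> with \<open>K v = F\<close>, where \<open>F\<close> is supported on the diagonal and at \<open>b\<close>, splits into two pieces.
  On the even vertices it is determined by \<open>c i = (-1)^(i+1) v(i,i)\<close>: the value at \<open>(x, x+2k)\<close> is, up to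
  the sign \<open>(-1)^(x+1)\<close>, the \<open>k\<close>-th forward difference of \<open>c\<close> at \<open>x\<close>. On the odd vertices it is determined by
  \<open>e i = (-1)^i v(i,i+1)\<close>: the value at \<open>(x, x+2k+1)\<close> is, up to sign, the \<open>k\<close>-fold iterated partial sum of
  \<open>e\<close> at \<open>x\<close>. The equations on the top row then say that certain differences of \<open>c\<close> vanish
  (\<open>differences_vanish\<close>) and that certain iterated sums of \<open>e\<close> vanish (\<open>sums_vanish\<close>), while the
  equations on the diagonal give \<open>e i = c (i+1) + c i - c 0\<close>, corrected by the partial sums of \<open>\<plusminus>F\<close>
  (\<open>near_seq_eq\<close>).

  For the column \<open>v = K^(-1)(\<cdot>, b)\<close> the inverse is antisymmetric because \<open>K\<close> is, hence \<open>v b = 0\<close>; this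
  forces \<open>c 0 = 1\<close>, with \<open>c (2n) = 1\<close> for even \<open>n\<close> and \<open>c (2n) = 0\<close> for odd \<open>n\<close>. One of the vanishing sums
  is \<open>e 0 + \<dots> + e (2n-1) = 0\<close>, which reads \<open>2 (c 0 + \<dots> + c (2n)) = c 0 + c (2n) + 2n\<close>. That is the claim,
  provided that \<open>K\<close> is invertible and that every \<open>c j\<close> is nonnegative.

  Both provisos are proved by counting weak sign alternations instead of perfect matchings. By a
  discrete Rolle theorem the vanishing iterated sums force \<open>n + 1\<close> alternations of \<open>e\<close>, a sequence
  \<open>d\<close> whose neighbour sums have the signs of \<open>e\<close> alternates at least as often, and suitable signs at the
  two ends of \<open>d\<close> force one alternation more. Differencing loses one alternation per step, and the
  vanishing differences of \<open>c\<close> shorten the range so quickly that an alternation would be left over at a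
  single point (\<open>boundary_signs_incompatible\<close>). For a vector in the kernel take \<open>d = 2 c / c 0 - 1\<close>; this
  leaves the case \<open>c 0 = 0\<close>, treated in \<open>vanishes_if_boundary_vanishes\<close>. For the sign of \<open>c j\<close> look at the column
  belonging to \<open>(j,j)\<close>: its own entry at \<open>(j,j)\<close> is 0 by antisymmetry, and at this zero two
  different rescalings of its sequence can be glued (\<open>inverse_on_diagonal_sign\<close>).
\<close>

section \<open>Invertibility of matrices indexed by a finite set\<close>

lemma ex_inverse_on_if_trivial_kernel:
  fixes A :: "'a \<Rightarrow> 'a \<Rightarrow> real"
  assumes fin: "finite I"
    and ker: "\<And>v z. (\<And>x. x \<in> I \<Longrightarrow> (\<Sum>z\<in>I. A x z * v z) = 0) \<Longrightarrow> (\<And>x. x \<notin> I \<Longrightarrow> v x = 0) \<Longrightarrow> z \<in> I \<Longrightarrow> v z = 0"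
  shows "\<exists>B. is_inverse_on I A B"
proof -
  define m where "m = card I"
  obtain h where h: "bij_betw h {0..<m} I"
    using ex_bij_betw_nat_finite[OF fin] unfolding m_def by blast
  define g where "g = inv_into {0..<m} h"
  have gh: "g (h i) = i" if "i < m" for i
    unfolding g_def using h that by (simp add: bij_betw_def)
  have hg: "h (g x) = x" "g x < m" if "x \<in> I" for x
    using h that bij_betw_inv_into_right[OF h] bij_betw_apply[OF bij_betw_inv_into[OF h]]
    unfolding g_def by auto
  have hI: "h i \<in> I" if "i < m" for i
    using h that by (auto dest: bij_betw_apply)
  have reindex: "(\<Sum>z\<in>I. F z) = (\<Sum>i = 0..<m. F (h i))" for F :: "'a \<Rightarrow> real"
    by (rule sum.reindex_bij_betw[OF h, symmetric])
  define M where "M = mat m m (\<lambda>(i, j). A (h i) (h j))"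
  have M: "M \<in> carrier_mat m m" unfolding M_def by simp
  have "det M \<noteq> 0"
  proof
    assume "det M = 0"
    then obtain v where v: "v \<in> carrier_vec m" "v \<noteq> 0\<^sub>v m" "M *\<^sub>v v = 0\<^sub>v m"
      using det_0_iff_vec_prod_zero[OF M] by blast
    define u where "u x = (if x \<in> I then v $ g x else 0)" for x
    have "(\<Sum>z\<in>I. A x z * u z) = 0" if x: "x \<in> I" for x
    proof -
      have "(\<Sum>z\<in>I. A x z * u z) = (\<Sum>i = 0..<m. A (h (g x)) (h i) * v $ i)"
        unfolding reindex by (rule sum.cong) (auto simp: u_def hI gh hg x)
      also have "\<dots> = (M *\<^sub>v v) $ g x"
        using v(1) hg(2)[OF x] by (auto simp: M_def scalar_prod_def)
      also have "\<dots> = 0" using hg(2)[OF x] by (simp add: v(3))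
      finally show ?thesis .
    qed
    then have "u z = 0" if "z \<in> I" for z
      using ker[of u z] that by (auto simp: u_def)
    then have "v $ i = 0" if "i < m" for i
      using that hI gh by (metis u_def)
    then have "v = 0\<^sub>v m" using v(1) by (intro eq_vecI) auto
    with v(2) show False by simp
  qed
  then have "M \<in> Units (ring_mat TYPE(real) m ())"
    by (rule det_non_zero_imp_unit[OF M])
  then obtain N where N: "N \<in> carrier_mat m m" "N * M = 1\<^sub>m m" "M * N = 1\<^sub>m m"
    unfolding Units_def by (auto simp: ring_mat_simps)
  define B where "B x y = (if x \<in> I \<and> y \<in> I then N $$ (g x, g y) else 0)" for x y
  have inj: "g x = g y \<longleftrightarrow> x = y" if "x \<in> I" "y \<in> I" for x y
    using hg that by metis
  have 1: "(\<Sum>z\<in>I. A x z * B z y) = (if x = y then 1 else 0)" if "x \<in> I" "y \<in> I" for x y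
  proof -
    have "(\<Sum>z\<in>I. A x z * B z y) = (M * N) $$ (g x, g y)"
      unfolding reindex using N(1) hg that
      by (auto simp: M_def B_def scalar_prod_def hI gh intro!: sum.cong)
    also have "\<dots> = (if x = y then 1 else 0)"
      using hg(2) that inj by (simp add: N(3))
    finally show ?thesis .
  qed
  have 2: "(\<Sum>z\<in>I. B x z * A z y) = (if x = y then 1 else 0)" if "x \<in> I" "y \<in> I" for x y
  proof -
    have "(\<Sum>z\<in>I. B x z * A z y) = (N * M) $$ (g x, g y)"
      unfolding reindex using N(1) hg that
      by (auto simp: M_def B_def scalar_prod_def hI gh intro!: sum.cong)
    also have "\<dots> = (if x = y then 1 else 0)"
      using hg(2) that inj by (simp add: N(2))
    finally show ?thesis .
  qed
  have "is_inverse_on I A B"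
    unfolding is_inverse_on_def using 1 2 by (auto simp: B_def)
  then show ?thesis by blast
qed

text \<open>The negated transpose of \<open>B\<close> is an inverse of \<open>A\<close> as well, and inverses are unique.\<close>

lemma inverse_on_antisym:
  assumes fin: "finite I" and B: "is_inverse_on I A B" and A: "\<And>x y. A x y = - A y x"
  shows "B x y = - B y x"
proof -
  have "is_inverse_on I A (\<lambda>x y. - B y x)"
    unfolding is_inverse_on_def
  proof (intro conjI ballI allI impI)
    fix x y assume xy: "x \<in> I" "y \<in> I"
    have "(\<Sum>z\<in>I. A x z * - B y z) = (\<Sum>z\<in>I. B y z * A z x)"
      by (rule sum.cong) (auto simp: A[of x])
    then show "(\<Sum>z\<in>I. A x z * - B y z) = (if x = y then 1 else 0)"
      using B xy by (auto simp: is_inverse_on_def)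
    have "(\<Sum>z\<in>I. - B z x * A z y) = (\<Sum>z\<in>I. A y z * B z x)"
      by (rule sum.cong) (auto simp: A[of _ y])
    then show "(\<Sum>z\<in>I. - B z x * A z y) = (if x = y then 1 else 0)"
      using B xy by (auto simp: is_inverse_on_def)
  next
    fix x y assume "x \<notin> I \<or> y \<notin> I"
    then show "- B y x = 0" using B by (auto simp: is_inverse_on_def)
  qed
  then show ?thesis
    using is_inverse_on_unique[OF fin B] by (metis (no_types))
qed

section \<open>Weak sign alternations and discrete Rolle theorems\<close>

definition fdiff :: "(nat \<Rightarrow> real) \<Rightarrow> nat \<Rightarrow> real" where
  "fdiff f i = f (Suc i) - f i"

definition psum :: "(nat \<Rightarrow> real) \<Rightarrow> nat \<Rightarrow> real" where
  "psum f t = (\<Sum>i\<le>t. f i)"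

text \<open>
  There are \<open>k\<close> points \<open>i\<^sub>1 < \<dots> < i\<^sub>k < t\<close> at which \<open>f\<close> has weakly alternating signs, the last of them having the
  sign of \<open>\<sigma>\<close>. Zeros count with either sign, so that a boundary zero can serve as an additional
  point. Peeling the points off from the right makes every Rolle argument below an induction on \<open>k\<close>.
\<close>

fun alternates :: "(nat \<Rightarrow> real) \<Rightarrow> nat \<Rightarrow> real \<Rightarrow> nat \<Rightarrow> bool" where
  "alternates f 0 \<sigma> t \<longleftrightarrow> True"
| "alternates f (Suc k) \<sigma> t \<longleftrightarrow> (\<exists>i<t. 0 \<le> \<sigma> * f i \<and> alternates f k (- \<sigma>) i)"

lemma alternates_mono: "alternates f k \<sigma> t \<Longrightarrow> t \<le> u \<Longrightarrow> alternates f k \<sigma> u"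
  by (cases k) (auto, meson less_le_trans)

lemma alternates_drop_first: "alternates f (Suc k) \<sigma> t \<Longrightarrow> alternates f k \<sigma> t"
proof (induction k arbitrary: \<sigma> t)
  case (Suc k)
  from Suc.prems obtain i where "i < t" "0 \<le> \<sigma> * f i" "alternates f (Suc k) (- \<sigma>) i"
    by (subst (asm) alternates.simps) blast
  with Suc.IH[OF this(3)] show ?case by auto
qed simp

lemma alternates_cong_sign:
  assumes "\<And>i s. i < t \<Longrightarrow> 0 \<le> s * f i \<Longrightarrow> 0 \<le> s * g i" "alternates f k \<sigma> t"
  shows "alternates g k \<sigma> t"
  using assms
proof (induction k arbitrary: \<sigma> t)
  case (Suc k)
  from Suc.prems(2) obtain i where i: "i < t" "0 \<le> \<sigma> * f i" "alternates f k (- \<sigma>) i"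
    by auto
  have "alternates g k (- \<sigma>) i" using Suc.IH[OF _ i(3)] Suc.prems(1) i(1) by auto
  with i Suc.prems(1) show ?case by auto
qed simp

text \<open>A strict sign at \<open>t\<close> prevents \<open>t\<close> from being a point of the opposite sign.\<close>

lemma alternates_below:
  assumes "alternates f k (- \<sigma>) (Suc t)" "0 < \<sigma> * f t"
  shows "alternates f k (- \<sigma>) t"
proof (cases k)
  case (Suc k')
  then obtain i where i: "i < Suc t" "0 \<le> - \<sigma> * f i" "alternates f k' (- (- \<sigma>)) i"
    using assms(1) by auto
  then have "i \<noteq> t" using assms(2) by auto
  with i Suc show ?thesis by (auto simp: less_Suc_eq)
qed simp

lemma ex_increasing_step:
  fixes g :: "nat \<Rightarrow> real"
  assumes "i < j" "g i \<le> g j"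
  shows "\<exists>l. i \<le> l \<and> l < j \<and> g l \<le> g (Suc l)"
  using assms
proof (induction j)
  case (Suc j)
  show ?case
  proof (cases "g j \<le> g (Suc j)")
    case True
    with Suc.prems(1) show ?thesis by (intro exI[of _ j]) auto
  next
    case False
    then have "g i \<le> g j" "i \<noteq> j" using Suc.prems(2) by auto
    with Suc.IH Suc.prems(1) show ?thesis by (auto simp: less_Suc_eq)
  qed
qed simp

lemma ex_strictly_increasing_step:
  fixes g :: "nat \<Rightarrow> real"
  assumes "i < j" "g i < g j"
  shows "\<exists>l. i \<le> l \<and> l < j \<and> g l < g (Suc l)"
  using assms
proof (induction j)
  case (Suc j)
  show ?case
  proof (cases "g j < g (Suc j)")
    case True
    with Suc.prems(1) show ?thesis by (intro exI[of _ j]) auto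
  next
    case False
    then have "g i < g j" "i \<noteq> j" using Suc.prems(2) by auto
    with Suc.IH Suc.prems(1) show ?thesis by (auto simp: less_Suc_eq)
  qed
qed simp

text \<open>
  Between a point of weak sign \<open>-\<sigma>\<close> and a later point of weak sign \<open>\<sigma>\<close> the sequence has a step of weak sign
  \<open>\<sigma>\<close>. The variant with a strict last sign keeps that strictness, which is what later allows the
  range to be shortened.
\<close>

lemma alternates_fdiff:
  assumes "alternates f k (- \<sigma>) i" "0 \<le> \<sigma> * f i"
  shows "alternates (fdiff f) k \<sigma> i"
  using assms
proof (induction k arbitrary: \<sigma> i)
  case (Suc k)
  from Suc.prems(1) obtain i' where i': "i' < i" "0 \<le> - \<sigma> * f i'" "alternates f k \<sigma> i'"
    by auto
  have IH: "alternates (fdiff f) k (- \<sigma>) i'" using Suc.IH[of "- \<sigma>" i'] i' by simp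
  obtain l where l: "i' \<le> l" "l < i" "\<sigma> * f l \<le> \<sigma> * f (Suc l)"
    using ex_increasing_step[of i' i "\<lambda>i. \<sigma> * f i"] i' Suc.prems(2) by auto
  have "0 \<le> \<sigma> * fdiff f l" using l(3) by (simp add: fdiff_def algebra_simps)
  with l alternates_mono[OF IH l(1)] show ?case by auto
qed simp

lemma alternates_fdiff_strict:
  assumes "alternates f (Suc k) (- \<sigma>) i" "0 < \<sigma> * f i"
  obtains l where "l < i" "0 < \<sigma> * fdiff f l" "alternates (fdiff f) k (- \<sigma>) l"
proof -
  from assms(1) obtain i' where i': "i' < i" "0 \<le> - \<sigma> * f i'" "alternates f k \<sigma> i'"
    by auto
  have R: "alternates (fdiff f) k (- \<sigma>) i'" using alternates_fdiff[of f k "- \<sigma>" i'] i' by simp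
  obtain l where l: "i' \<le> l" "l < i" "\<sigma> * f l < \<sigma> * f (Suc l)"
    using ex_strictly_increasing_step[of i' i "\<lambda>i. \<sigma> * f i"] i' assms(2) by auto
  have "0 < \<sigma> * fdiff f l" using l(3) by (simp add: fdiff_def algebra_simps)
  with l alternates_mono[OF R l(1)] that show ?thesis by auto
qed

text \<open>
  The value 0 of the empty sum acts as a further point to the left of index 0, so passing from the
  partial sums to the summands loses no alternation.
\<close>

lemma alternates_summand:
  assumes "alternates (psum f) k (- \<sigma>) i" "0 \<le> \<sigma> * psum f i"
  shows "alternates f (Suc k) \<sigma> (Suc i)"
  using assms
proof (induction k arbitrary: \<sigma> i)
  case 0
  have "\<exists>l\<le>i. 0 \<le> \<sigma> * f l"
  proof (rule ccontr)
    assume "\<not> ?thesis"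
    then have "\<sigma> * f l < 0" if "l \<le> i" for l using that by (meson not_le)
    then have "(\<Sum>l\<le>i. \<sigma> * f l) < (\<Sum>l\<le>i. 0)" by (intro sum_strict_mono) auto
    with 0 show False by (simp add: psum_def sum_distrib_left)
  qed
  then show ?case by (auto simp: less_Suc_eq_le)
next
  case (Suc k)
  from Suc.prems(1) obtain i' where i': "i' < i" "0 \<le> - \<sigma> * psum f i'" "alternates (psum f) k \<sigma> i'"
    by auto
  have IH: "alternates f (Suc k) (- \<sigma>) (Suc i')" using Suc.IH[of "- \<sigma>" i'] i' by simp
  obtain l where l: "i' \<le> l" "l < i" "\<sigma> * psum f l \<le> \<sigma> * psum f (Suc l)"
    using ex_increasing_step[of i' i "\<lambda>i. \<sigma> * psum f i"] i' Suc.prems(2) by auto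
  have "0 \<le> \<sigma> * f (Suc l)" using l(3) by (simp add: psum_def algebra_simps)
  moreover have "alternates f (Suc k) (- \<sigma>) (Suc l)" using alternates_mono[OF IH] l(1) by simp
  ultimately show ?case using l(2) by (subst alternates.simps) auto
qed

lemma alternates_psum_imp:
  assumes "alternates (psum f) k \<sigma> t"
  shows "alternates f k \<sigma> t"
proof (cases k)
  case (Suc k')
  then obtain i where i: "i < t" "0 \<le> \<sigma> * psum f i" "alternates (psum f) k' (- \<sigma>) i"
    using assms by auto
  show ?thesis using alternates_mono[OF alternates_summand[OF i(3,2)], of t] i(1) Suc by simp
qed simp

text \<open>
  If \<open>d i + d (i+1)\<close> has weak sign \<open>\<sigma>\<close>, then so has \<open>d (i+1)\<close> or \<open>d i\<close>. Preferring the right neighbour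
  keeps the chosen points distinct: the left one is used only if \<open>d (i+1)\<close> has strict sign \<open>-\<sigma>\<close>, in
  which case \<open>d i\<close> has strict sign \<open>\<sigma>\<close> and is not a point already chosen for \<open>-\<sigma>\<close>.
\<close>

lemma alternates_smoothing_step:
  assumes "alternates d k (- \<sigma>) (Suc i)" "0 \<le> \<sigma> * (d i + d (Suc i))" "i < t"
  shows "alternates d (Suc k) \<sigma> (Suc t)"
proof (cases "0 \<le> \<sigma> * d (Suc i)")
  case True
  then show ?thesis using assms by auto
next
  case False
  then have "0 < \<sigma> * d i" using assms(2) by (simp add: algebra_simps)
  with alternates_below[OF assms(1)] assms(3) show ?thesis
    by (auto intro!: exI[of _ i])
qed

lemma alternates_smoothing:
  assumes "alternates (\<lambda>i. d i + d (Suc i)) k \<sigma> t"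
  shows "alternates d k \<sigma> (Suc t)"
  using assms
proof (induction k arbitrary: \<sigma> t)
  case (Suc k)
  then obtain i where "i < t" "0 \<le> \<sigma> * (d i + d (Suc i))" "alternates (\<lambda>i. d i + d (Suc i)) k (- \<sigma>) i"
    by auto
  with alternates_smoothing_step[OF Suc.IH[of "- \<sigma>" i], of t] show ?case by blast
qed simp

text \<open>
  With the right neighbour preferred, a zero \<open>d 0\<close> remains free and contributes an extra point.
\<close>

lemma alternates_smoothing_zero:
  assumes "alternates (\<lambda>i. d i + d (Suc i)) k \<sigma> t" "d 0 = 0"
  shows "alternates d (Suc k) \<sigma> (Suc t)"
  using assms(1)
proof (induction k arbitrary: \<sigma> t)
  case 0
  show ?case using assms(2) by auto
next
  case (Suc k)
  then obtain i where "i < t" "0 \<le> \<sigma> * (d i + d (Suc i))" "alternates (\<lambda>i. d i + d (Suc i)) k (- \<sigma>) i"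
    by auto
  with alternates_smoothing_step[OF Suc.IH[of "- \<sigma>" i], of t] show ?case by blast
qed

text \<open>The hypothesis on \<open>\<sigma>\<close> says that the first of the \<open>k\<close> points carries a negative sign.\<close>

lemma alternates_prepend:
  assumes "alternates d k \<sigma> t" "0 < d 0" "\<sigma> * (- 1) ^ k = 1" "0 < t"
  shows "alternates d (Suc k) \<sigma> t"
  using assms(1,3,4)
proof (induction k arbitrary: \<sigma> t)
  case 0
  then show ?case using assms(2) by auto
next
  case (Suc k)
  then obtain i where i: "i < t" "0 \<le> \<sigma> * d i" "alternates d k (- \<sigma>) i" by auto
  have "i \<noteq> 0"
  proof
    assume "i = 0"
    with i(3) have "k = 0" by (cases k) auto
    then have "\<sigma> = - 1" using Suc.prems(2) by simp
    with i(2) \<open>i = 0\<close> assms(2) show False by simp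
  qed
  then have "alternates d (Suc k) (- \<sigma>) i" using Suc.IH[OF i(3)] Suc.prems(2) by simp
  with i show ?case by (subst alternates.simps) blast
qed

section \<open>Sequences with vanishing iterated sums and differences\<close>

text \<open>
  Each vanishing sum is a boundary zero at the right end of the range reached so far. Together with the
  empty sum at the left end it yields one additional alternation in the next lower sum.
\<close>

lemma alternates_if_iterated_sums_vanish:
  assumes B: "\<And>m. m < n \<Longrightarrow> (psum ^^ (n - m)) e (2 * m + 1) = 0"
    and R: "1 \<le> R" "R \<le> n"
  shows "\<exists>\<sigma>\<in>{1, - 1}. alternates e (Suc R) \<sigma> (2 * R)"
proof -
  have "\<exists>\<sigma>\<in>{1, - 1}. alternates ((psum ^^ (n - R)) e) (Suc R) \<sigma> (2 * R)"
    using R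
  proof (induction R rule: dec_induct)
    case base
    define s where "s = (psum ^^ n) e"
    have s: "s = psum ((psum ^^ (n - Suc 0)) e)"
      using base unfolding s_def by (cases n) auto
    have "s 1 = 0" using B[of 0] base unfolding s_def by simp
    obtain \<sigma> :: real where \<sigma>: "\<sigma> \<in> {1, - 1}" "0 \<le> \<sigma> * s 0"
      by (cases "0 \<le> s 0") force+
    then have "alternates s 1 \<sigma> 1" by auto
    then have "alternates ((psum ^^ (n - Suc 0)) e) 2 (- \<sigma>) 2"
      using alternates_summand[of "(psum ^^ (n - Suc 0)) e" 1 "- \<sigma>" 1] \<open>s 1 = 0\<close>
      by (simp add: s[symmetric] numeral_2_eq_2 del: alternates.simps)
    with \<sigma>(1) show ?case by (auto simp: numeral_2_eq_2 simp del: alternates.simps)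
  next
    case (step R)
    (* The zero of s at 2R+1 takes the sign opposite to the last point found so far. *)
    define s where "s = (psum ^^ (n - R)) e"
    have s: "s = psum ((psum ^^ (n - Suc R)) e)"
      using step.prems unfolding s_def by (metis Suc_diff_Suc Suc_le_lessD comp_apply funpow.simps(2))
    have "s (2 * R + 1) = 0" using B[of R] step.prems unfolding s_def by simp
    obtain \<sigma> where \<sigma>: "\<sigma> \<in> {1, - 1}" "alternates s (Suc R) \<sigma> (2 * R)"
      using step.IH step.prems unfolding s_def by (auto simp del: alternates.simps)
    then have "alternates s (Suc R) \<sigma> (2 * R + 1)" by (elim alternates_mono) simp
    then have "alternates ((psum ^^ (n - Suc R)) e) (Suc (Suc R)) (- \<sigma>) (Suc (2 * R + 1))"
      using alternates_summand[of "(psum ^^ (n - Suc R)) e" "Suc R" "- \<sigma>" "2 * R + 1"]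
        \<open>s (2 * R + 1) = 0\<close>
      by (simp add: s[symmetric] del: alternates.simps)
    with \<sigma>(1) show ?case by (auto simp del: alternates.simps)
  qed
  then obtain \<sigma> where \<sigma>: "\<sigma> \<in> {1, - 1}" "alternates ((psum ^^ (n - R)) e) (Suc R) \<sigma> (2 * R)" by blast
  have "alternates e (Suc R) \<sigma> (2 * R)" if "alternates ((psum ^^ p) e) (Suc R) \<sigma> (2 * R)" for p
    using that by (induction p) (auto simp del: alternates.simps dest: alternates_psum_imp)
  with \<sigma> show ?thesis by blast
qed

text \<open>
  The vanishing of the next difference at \<open>2n - 2r\<close> says that the last two admissible values of the
  \<open>r\<close>-th difference agree, so a strict last sign moves one place to the left. Together with Rolle
  the range loses two places and the count one point per step, until two points would have to
  fit into \<open>{0}\<close>.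
\<close>

lemma no_alternation_if_differences_vanish:
  assumes A: "\<And>r. 1 \<le> r \<Longrightarrow> r \<le> n \<Longrightarrow> (fdiff ^^ Suc r) c (2 * n - 2 * r) = 0"
    and r: "1 \<le> r" "r \<le> n"
    and i: "i < 2 * n - 2 * r + 2" "0 < \<sigma> * (fdiff ^^ r) c i"
      "alternates ((fdiff ^^ r) c) (n + 1 - r) (- \<sigma>) i"
  shows False
  using r i
proof (induction "n - r" arbitrary: r i)
  case (0 r i)
  define f where "f = (fdiff ^^ r) c"
  have "r = n" using 0 by simp
  then have "f 1 = f 0" using A[of n] 0 unfolding f_def by (simp add: fdiff_def)
  obtain i' where "i' < i" "0 \<le> - \<sigma> * f i'" using 0 \<open>r = n\<close> by (auto simp: f_def)
  moreover have "i < 2" using 0 \<open>r = n\<close> by simp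
  ultimately have "i = 1" "i' = 0" by auto
  with \<open>f 1 = f 0\<close> \<open>0 \<le> - \<sigma> * f i'\<close> "0.prems"(4) show False by (simp add: f_def)
next
  case (Suc k r i)
  define f where "f = (fdiff ^^ r) c"
  define q where "q = 2 * n - 2 * r"
  have "r < n" using Suc by simp
  have q: "f (Suc q) = f q" using A[of r] Suc.prems unfolding f_def q_def by (simp add: fdiff_def)
  have k: "n + 1 - r = Suc (n + 1 - Suc r)" using \<open>r < n\<close> by simp
  have alt: "alternates f (n + 1 - r) (- \<sigma>) i" and fi: "0 < \<sigma> * f i" using Suc.prems by (auto simp: f_def)
  obtain i' where i': "i' \<le> q" "0 < \<sigma> * f i'" "alternates f (n + 1 - r) (- \<sigma>) i'"
  proof (cases "i \<le> q")
    case True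
    with alt fi that show ?thesis by blast
  next
    case False
    then have "i = Suc q" using Suc.prems(3) unfolding q_def by simp
    with alternates_below[of f _ \<sigma> q] alt fi q that[of q] show ?thesis by auto
  qed
  obtain l where l: "l < i'" "0 < \<sigma> * fdiff f l" "alternates (fdiff f) (n + 1 - Suc r) (- \<sigma>) l"
    using alternates_fdiff_strict[OF i'(3)[unfolded k] i'(2)] by blast
  have "fdiff f = (fdiff ^^ Suc r) c" by (simp add: f_def)
  moreover have "l < 2 * n - 2 * Suc r + 2" using l(1) i'(1) \<open>r < n\<close> unfolding q_def by simp
  moreover have "k = n - Suc r" using Suc.hyps(2) by simp
  ultimately show False using Suc.hyps(1)[of "Suc r" l] l \<open>r < n\<close> by simp
qed

text \<open>
  Forcing \<open>n + 1\<close> alternations on \<open>d\<close>, the sums leave open which sign comes last. In either case the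
  boundary signs supply one more: if the last sign differs from that of \<open>d (2n)\<close>, append the point \<open>2n\<close>;
  otherwise move the last point to \<open>2n\<close>, and then the first sign is negative by parity, so the
  point 0 can be prepended. The weight \<open>\<rho>\<close> affects no sign and lets \<open>d\<close> be a rescaling of \<open>c\<close> with
  different factors on different ranges.
\<close>

lemma boundary_signs_incompatible:
  assumes A: "\<And>r. 1 \<le> r \<Longrightarrow> r \<le> n \<Longrightarrow> (fdiff ^^ Suc r) c (2 * n - 2 * r) = 0"
    and B: "\<And>m. m < n \<Longrightarrow> (psum ^^ (n - m)) e (2 * m + 1) = 0"
    and n: "1 \<le> n"
    and \<rho>: "\<And>i. 0 < \<rho> i"
    and e: "\<And>i. i < 2 * n \<Longrightarrow> e i = \<rho> i * (d i + d (Suc i))"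
    and c: "\<And>i. i < 2 * n \<Longrightarrow> c (Suc i) - c i = \<rho> i * (d (Suc i) - d i)"
    and d0: "0 < d 0" and dn: "(- 1) ^ n * d (2 * n) < 0"
  shows False
proof -
  define \<tau> :: real where "\<tau> = - ((- 1) ^ n)"
  have \<tau>: "\<tau> \<in> {1, - 1}" unfolding \<tau>_def by (cases "even n") auto
  have d\<tau>: "0 < \<tau> * d (2 * n)" using dn by (simp add: \<tau>_def)
  obtain \<sigma> where \<sigma>: "\<sigma> \<in> {1, - 1}" "alternates e (Suc n) \<sigma> (2 * n)"
    using alternates_if_iterated_sums_vanish[OF B, of n] n by (auto simp del: alternates.simps)
  have "alternates (\<lambda>i. d i + d (Suc i)) (Suc n) \<sigma> (2 * n)"
  proof (rule alternates_cong_sign[OF _ \<sigma>(2)])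
    fix i and s :: real assume i: "i < 2 * n" and "0 \<le> s * e i"
    then have "0 \<le> \<rho> i * (s * (d i + d (Suc i)))" by (simp add: e ac_simps)
    then show "0 \<le> s * (d i + d (Suc i))" using \<rho>[of i] by (simp add: zero_le_mult_iff)
  qed
  then have alt: "alternates d (Suc n) \<sigma> (Suc (2 * n))" by (rule alternates_smoothing)
  have "alternates d (Suc n) (- \<tau>) (2 * n)"
  proof (cases "\<sigma> = \<tau>")
    case True
    with alt obtain i where i: "i < Suc (2 * n)" "alternates d n (- \<tau>) i" by auto
    have "- \<tau> * (- 1) ^ n = 1" by (simp add: \<tau>_def flip: power_mult_distrib)
    moreover have "alternates d n (- \<tau>) (2 * n)" using alternates_mono[OF i(2)] i(1) by simp
    ultimately show ?thesis using alternates_prepend[of d n "- \<tau>" "2 * n"] d0 n by simp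
  next
    case False
    then have "\<sigma> = - \<tau>" using \<sigma>(1) \<tau> by auto
    with alternates_below[where f = d and \<sigma> = \<tau> and t = "2 * n", OF _ d\<tau>] alt show ?thesis by blast
  qed
  from alternates_fdiff_strict[OF this d\<tau>] obtain l
    where l: "l < 2 * n" "0 < \<tau> * fdiff d l" "alternates (fdiff d) n (- \<tau>) l" .
  have sgn: "fdiff c i = \<rho> i * fdiff d i" if "i < 2 * n" for i
    using c that by (simp add: fdiff_def)
  have "alternates (fdiff c) n (- \<tau>) l"
  proof (rule alternates_cong_sign[OF _ l(3)])
    fix i and s :: real assume "i < l" "0 \<le> s * fdiff d i"
    then have "0 \<le> \<rho> i * (s * fdiff d i)" using \<rho>[of i] by simp
    then show "0 \<le> s * fdiff c i" using \<open>i < l\<close> l(1) by (simp add: sgn ac_simps)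
  qed
  moreover have "0 < \<rho> l * (\<tau> * fdiff d l)" using \<rho>[of l] l(2) by simp
  then have "0 < \<tau> * fdiff c l" using l(1) by (simp add: sgn ac_simps)
  moreover have "l < 2 * n - 2 * 1 + 2" using l(1) by linarith
  ultimately show False
    using no_alternation_if_differences_vanish[OF A, of 1 l \<tau>] n by simp
qed

lemma fdiff_iterate_last:
  assumes "\<And>i. M < i \<Longrightarrow> c i = 0"
  shows "(\<forall>i>M. (fdiff ^^ p) c i = 0) \<and> (fdiff ^^ p) c M = (- 1) ^ p * c M"
  using assms by (induction p) (auto simp: fdiff_def)

text \<open>
  Here no strict sign is available at the ends. It is replaced by the last nonzero value \<open>c M\<close>: the
  vanishing differences force \<open>M = 2R + 1\<close>, the sums force enough alternations to the left of \<open>M\<close>,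
  and under differencing \<open>M\<close> remains the last nonzero index with alternating sign, so that no
  alternation is lost before the \<open>r\<close>-th difference, \<open>r = n - R\<close>. From there on the range is too short.
\<close>

lemma vanishes_if_boundary_vanishes:
  assumes A: "\<And>r. 1 \<le> r \<Longrightarrow> r \<le> n \<Longrightarrow> (fdiff ^^ Suc r) c (2 * n - 2 * r) = 0"
    and B: "\<And>m. m < n \<Longrightarrow> (psum ^^ (n - m)) e (2 * m + 1) = 0"
    and e: "\<And>i. i < 2 * n \<Longrightarrow> e i = c i + c (Suc i)"
    and c0: "c 0 = 0" and cn: "\<And>i. 2 * n \<le> i \<Longrightarrow> c i = 0"
  shows "c i = 0"
proof (rule ccontr)
  assume "c i \<noteq> 0"
  define M where "M = Max {i. c i \<noteq> 0}"
  have sub: "{i. c i \<noteq> 0} \<subseteq> {..<2 * n}" using cn by (force simp: not_le[symmetric])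
  then have fin: "finite {i. c i \<noteq> 0}" by (rule finite_subset) simp
  have "M \<in> {i. c i \<noteq> 0}" unfolding M_def using fin \<open>c i \<noteq> 0\<close> by (intro Max_in) auto
  then have M: "c M \<noteq> 0" "M < 2 * n" using sub by auto
  have beyond: "c i = 0" if "M < i" for i
  proof (rule ccontr)
    assume "c i \<noteq> 0"
    then have "i \<le> M" unfolding M_def using fin by (intro Max_ge) auto
    with that show False by simp
  qed
  note last = fdiff_iterate_last[of M c, OF beyond]
  have "odd M"
  proof
    assume "even M"
    then obtain k where k: "M = 2 * k" by (rule evenE)
    have "(fdiff ^^ Suc (n - k)) c M = 0"
      using A[of "n - k"] M(2) k by (simp add: right_diff_distrib' del: funpow.simps)
    with last[of "Suc (n - k)"] M(1) show False by (simp del: funpow.simps)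
  qed
  then obtain R where R: "M = 2 * R + 1" by (rule oddE)
  define r where "r = n - R"
  have r: "1 \<le> r" "r \<le> n" "n = R + r" using R M(2) unfolding r_def by auto
  obtain \<tau> :: real where \<tau>: "\<tau> \<in> {1, - 1}" "0 < \<tau> * c M"
    using M(1) by (cases "0 < c M") force+
  have alt: "alternates c (Suc R) (- \<tau>) M"
  proof (cases "R = 0")
    case True
    then show ?thesis using c0 R by auto
  next
    case False
    then obtain \<sigma> where \<sigma>: "\<sigma> \<in> {1, - 1}" "alternates e (Suc R) \<sigma> (2 * R)"
      using alternates_if_iterated_sums_vanish[OF B, of R] r by (auto simp del: alternates.simps)
    have "alternates (\<lambda>i. c i + c (Suc i)) (Suc R) \<sigma> (2 * R)"
      by (rule alternates_cong_sign[OF _ \<sigma>(2)]) (use e r in auto)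
    then have alt: "alternates c (Suc (Suc R)) \<sigma> M"
      using alternates_smoothing_zero[of c, OF _ c0] R by (simp del: alternates.simps)
    show ?thesis
    proof (cases "\<sigma> = \<tau>")
      case True
      with alt obtain i where i: "i < M" "alternates c (Suc R) (- \<tau>) i"
        by (subst (asm) alternates.simps) blast
      then show ?thesis by (elim alternates_mono) simp
    next
      case False
      then have "\<sigma> = - \<tau>" using \<sigma>(1) \<tau>(1) by auto
      with alt show ?thesis using alternates_drop_first by blast
    qed
  qed
  have "alternates ((fdiff ^^ p) c) (Suc R) (- (\<tau> * (- 1) ^ p)) M" for p
  proof (induction p)
    case 0
    show ?case using alt by (simp del: alternates.simps)
  next
    case (Suc p)
    have "\<tau> * (- 1) ^ p * (fdiff ^^ p) c M = \<tau> * c M"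
      using last[of p] by (simp flip: power_mult_distrib)
    then have "0 \<le> \<tau> * (- 1) ^ p * (fdiff ^^ p) c M" using \<tau>(2) by linarith
    from alternates_fdiff[OF Suc.IH this] show ?case by (simp del: alternates.simps)
  qed
  note alt_r = this[of r]
  have "\<tau> * (- 1) ^ r * (fdiff ^^ r) c M = \<tau> * c M"
    using last[of r] by (simp flip: power_mult_distrib)
  then have "0 < \<tau> * (- 1) ^ r * (fdiff ^^ r) c M" using \<tau>(2) by linarith
  then show False
    using no_alternation_if_differences_vanish[OF A, of r M "\<tau> * (- 1) ^ r"] alt_r r R
    by (simp del: alternates.simps)
qed

section \<open>The Kasteleyn equations\<close>

lemma finite_G_verts: "finite (G_verts n)"
proof (rule finite_subset)
  show "G_verts n \<subseteq> {0..2 * int n} \<times> {0..2 * int n + 1}" by (auto simp: G_verts_def)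
qed simp

lemma b_vertex_even: "even n \<Longrightarrow> b_vertex n = (int (2 * n), int (2 * n) + 1)"
  by (auto simp: b_vertex_def)

lemma b_vertex_odd: "odd n \<Longrightarrow> b_vertex n = (int (2 * n), int (2 * n))"
proof -
  assume "odd n"
  then have "int n mod 2 = 1" by presburger
  then show ?thesis by (simp add: b_vertex_def)
qed

lemma b_vertex_in_G_verts: "b_vertex n \<in> G_verts n"
  by (cases "even n") (auto simp: b_vertex_even b_vertex_odd G_verts_def)

definition kast_apply :: "nat \<Rightarrow> (vertex \<Rightarrow> real) \<Rightarrow> vertex \<Rightarrow> real" where
  "kast_apply n v y = (\<Sum>z\<in>G_verts n. kast y z * v z)"

lemma kast_antisym: "kast x y = - kast y x"
  by (simp add: kast_def)

lemma kast_entry_eq: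
  "kast_entry (x1, x2) (y1, y2) =
     (if even (x1 + x2) \<and> x2 = y2 \<and> x1 = y1 + 1 \<or>
         even (x1 + x2) \<and> x1 = y1 \<and> (y2 = x2 + 1 \<or> y2 = x2 - 1) \<or>
         x1 = x2 \<and> y1 = x1 - 1 \<and> y2 = x1 - 1
      then 1 else 0)"
proof -
  have "\<bar>y2 - x2\<bar> = 1 \<longleftrightarrow> y2 = x2 + 1 \<or> y2 = x2 - 1" "x1 - y1 = 1 \<longleftrightarrow> x1 = y1 + 1" by auto
  then show ?thesis unfolding kast_entry.simps even_iff_mod_2_eq_zero by (simp only: conj_ac)
qed

lemma kast_apply_neighbours:
  assumes "\<And>z. z \<notin> G_verts n \<Longrightarrow> v z = 0"
  shows "kast_apply n v (x1, x2) =
    kast (x1, x2) (x1 - 1, x2) * v (x1 - 1, x2) + kast (x1, x2) (x1 + 1, x2) * v (x1 + 1, x2) +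
    kast (x1, x2) (x1, x2 - 1) * v (x1, x2 - 1) + kast (x1, x2) (x1, x2 + 1) * v (x1, x2 + 1) +
    kast (x1, x2) (x1 - 1, x2 - 1) * v (x1 - 1, x2 - 1) +
    kast (x1, x2) (x1 + 1, x2 + 1) * v (x1 + 1, x2 + 1)" (is "_ = ?rhs")
proof -
  let ?f = "\<lambda>z. kast (x1, x2) z * v z"
  let ?N = "{(x1 - 1, x2), (x1 + 1, x2), (x1, x2 - 1), (x1, x2 + 1), (x1 - 1, x2 - 1), (x1 + 1, x2 + 1)}"
  have far: "kast (x1, x2) z = 0" if "z \<notin> ?N" for z
  proof -
    obtain y1 y2 where z: "z = (y1, y2)" by (cases z)
    note apart = that[unfolded z insert_iff prod.inject empty_iff]
    have "kast_entry (x1, x2) (y1, y2) = 0"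
      unfolding kast_entry_eq by (rule if_not_P) (use apart in presburger)
    moreover have "kast_entry (y1, y2) (x1, x2) = 0"
      unfolding kast_entry_eq by (rule if_not_P) (use apart in presburger)
    ultimately show ?thesis by (simp add: z kast_def)
  qed
  have "sum ?f (G_verts n) = sum ?f (G_verts n \<union> ?N)"
    using finite_G_verts assms by (intro sum.mono_neutral_left) auto
  also have "\<dots> = sum ?f ?N"
    using finite_G_verts far by (intro sum.mono_neutral_right) auto
  also have "\<dots> = ?rhs" by simp
  finally show ?thesis by (simp add: kast_apply_def)
qed

lemma kast_horizontal:
  "kast (x1, x2) (x1 - 1, x2) = (if even (x1 + x2) then 1 else 0)"
  "kast (x1, x2) (x1 + 1, x2) = (if even (x1 + x2) then 0 else - 1)"
  unfolding kast_def kast_entry_eq by (cases "x1 = x2"; simp)+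

lemma kast_vertical:
  "kast (x1, x2) (x1, x2 - 1) = (if even (x1 + x2) then 1 else - 1)"
  "kast (x1, x2) (x1, x2 + 1) = (if even (x1 + x2) then 1 else - 1)"
  unfolding kast_def kast_entry_eq by (cases "x1 = x2"; simp)+

lemma kast_diagonal:
  "kast (x1, x2) (x1 - 1, x2 - 1) = (if x1 = x2 then 1 else 0)"
  "kast (x1, x2) (x1 + 1, x2 + 1) = (if x1 = x2 then - 1 else 0)"
  unfolding kast_def kast_entry_eq by (cases "x1 = x2"; simp)+

lemmas kast_neighbour_entries = kast_horizontal kast_vertical kast_diagonal

lemma kast_apply_odd:
  assumes "\<And>z. z \<notin> G_verts n \<Longrightarrow> v z = 0" "odd (x1 + x2)"
  shows "kast_apply n v (x1, x2) = - (v (x1, x2 + 1) + v (x1, x2 - 1) + v (x1 + 1, x2))"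
proof -
  have "x1 \<noteq> x2" using assms(2) by auto
  with assms(2) show ?thesis
    by (subst kast_apply_neighbours) (simp_all add: assms(1) kast_neighbour_entries)
qed

lemma kast_apply_even:
  assumes "\<And>z. z \<notin> G_verts n \<Longrightarrow> v z = 0" "even (x1 + x2)" "x1 \<noteq> x2"
  shows "kast_apply n v (x1, x2) = v (x1, x2 + 1) + v (x1, x2 - 1) + v (x1 - 1, x2)"
  using assms(2,3)
  by (subst kast_apply_neighbours) (simp_all add: assms(1) kast_neighbour_entries)

lemma kast_apply_diagonal:
  assumes "\<And>z. z \<notin> G_verts n \<Longrightarrow> v z = 0"
  shows "kast_apply n v (x, x) = v (x, x + 1) + v (x - 1, x) + v (x - 1, x - 1) - v (x + 1, x + 1)"
proof -
  have "v (x, x - 1) = 0" "v (x + 1, x) = 0" using assms by (auto simp: G_verts_def)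
  then show ?thesis
    by (subst kast_apply_neighbours) (simp_all add: assms kast_neighbour_entries)
qed

text \<open>
  The signs turn the sums over neighbours in the Kasteleyn equations into forward differences and
  partial sums; they also make \<open>diag_seq\<close> of the column at \<open>b\<close> nonnegative.
\<close>

definition diag_seq :: "(vertex \<Rightarrow> real) \<Rightarrow> nat \<Rightarrow> real" where
  "diag_seq v i = (- 1) ^ Suc i * v (int i, int i)"

definition near_seq :: "(vertex \<Rightarrow> real) \<Rightarrow> nat \<Rightarrow> real" where
  "near_seq v i = (- 1) ^ i * v (int i, int i + 1)"

locale diagonal_source =
  fixes n :: nat and v :: "vertex \<Rightarrow> real"
  assumes outside: "\<And>z. z \<notin> G_verts n \<Longrightarrow> v z = 0"
    and interior: "\<And>x1 x2. (x1, x2) \<in> G_verts n \<Longrightarrow> x1 \<noteq> x2 \<Longrightarrow> (x1, x2) \<noteq> b_vertex n \<Longrightarrow>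
      kast_apply n v (x1, x2) = 0"
begin

lemma vertex_eq_diag:
  "x + 2 * k \<le> 2 * n + 1 \<Longrightarrow> v (int x, int x + 2 * int k) = (- 1) ^ Suc x * (fdiff ^^ k) (diag_seq v) x"
proof (induction k arbitrary: x)
  case 0
  show ?case by (simp add: diag_seq_def flip: power_mult_distrib)
next
  case (Suc k)
  have "kast_apply n v (int x, int x + 2 * int k + 1) = 0"
    using Suc.prems by (intro interior) (auto simp: G_verts_def b_vertex_def)
  then have "v (int x, int x + 2 * int k + 2) + v (int x, int x + 2 * int k)
      + v (int (Suc x), int (Suc x) + 2 * int k) = 0"
    by (subst (asm) kast_apply_odd[OF outside]) (auto simp: algebra_simps)
  with Suc.IH[of x] Suc.IH[of "Suc x"] Suc.prems show ?case
    by (simp add: fdiff_def algebra_simps)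
qed

lemma vertex_eq_near:
  "x + 2 * k \<le> 2 * n \<Longrightarrow> v (int x, int x + 2 * int k + 1) = (- 1) ^ (x + k) * (psum ^^ k) (near_seq v) x"
proof (induction k arbitrary: x)
  case 0
  show ?case by (simp add: near_seq_def flip: power_mult_distrib)
next
  case (Suc k)
  note IH = Suc.IH
  show ?case using Suc.prems
  proof (induction x)
    case 0
    have "kast_apply n v (0, 2 * int k + 2) = 0"
      using 0 by (intro interior) (auto simp: G_verts_def b_vertex_def)
    moreover have "v (- 1, 2 * int k + 2) = 0" by (rule outside) (auto simp: G_verts_def)
    ultimately have "v (0, 2 * int k + 3) + v (0, 2 * int k + 1) = 0"
      by (subst (asm) kast_apply_even[OF outside]) (auto simp: algebra_simps)
    with IH[of 0] 0 show ?case by (simp add: psum_def algebra_simps)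
  next
    case (Suc x)
    have "kast_apply n v (int x + 1, int x + 2 * int k + 3) = 0"
      using Suc.prems by (intro interior) (auto simp: G_verts_def b_vertex_def)
    then have "v (int x + 1, int x + 2 * int k + 4) + v (int x + 1, int x + 2 * int k + 2)
        + v (int x, int x + 2 * int k + 3) = 0"
      by (subst (asm) kast_apply_even[OF outside]) (auto simp: algebra_simps)
    with Suc.IH IH[of "Suc x"] Suc.prems show ?case
      by (simp add: psum_def algebra_simps)
  qed
qed

text \<open>
  The vertices beyond the top row are missing, so the equations on the top row express that the next
  step of the two recursions above would produce the value 0.
\<close>

lemma differences_vanish:
  assumes "1 \<le> r" "r \<le> n"
  shows "(fdiff ^^ Suc r) (diag_seq v) (2 * n - 2 * r) = 0"
proof -
  define x where "x = 2 * n - 2 * r"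
  have x: "int x + 2 * int r = 2 * int n" "x + 2 * r = 2 * n" "even x" using assms unfolding x_def by auto
  have "kast_apply n v (int x, int x + 2 * int r + 1) = 0"
    using assms x by (intro interior) (auto simp: G_verts_def b_vertex_def)
  moreover have "v (int x, int x + 2 * int r + 2) = 0"
    using x by (intro outside) (auto simp: G_verts_def)
  ultimately have "v (int x, int x + 2 * int r) + v (int (Suc x), int (Suc x) + 2 * int r) = 0"
    by (subst (asm) kast_apply_odd[OF outside]) (use x(3) in \<open>auto simp: algebra_simps\<close>)
  with vertex_eq_diag[of x r] vertex_eq_diag[of "Suc x" r] x(2,3) show ?thesis
    unfolding x_def[symmetric] by (simp add: fdiff_def)
qed

lemma sums_vanish:
  assumes "m < n"
  shows "(psum ^^ (n - m)) (near_seq v) (2 * m + 1) = 0"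
proof -
  obtain k where k: "n = Suc (m + k)" using assms less_iff_Suc_add by auto
  have "kast_apply n v (2 * int m + 1, 2 * int n + 1) = 0"
    using assms by (intro interior) (auto simp: G_verts_def b_vertex_def)
  moreover have "v (2 * int m + 1, 2 * int n + 2) = 0" by (rule outside) (auto simp: G_verts_def)
  ultimately have "v (int (2 * m + 1), int (2 * m + 1) + 2 * int k + 1)
      + v (int (2 * m), int (2 * m) + 2 * int (Suc k) + 1) = 0"
    by (subst (asm) kast_apply_even[OF outside]) (use k in \<open>auto simp: algebra_simps\<close>)
  with vertex_eq_near[of "2 * m + 1" k] vertex_eq_near[of "2 * m" "Suc k"] k show ?thesis
    by (cases "even k") (simp_all add: psum_def)
qed

lemma near_seq_eq:
  "i \<le> 2 * n \<Longrightarrow> near_seq v i = diag_seq v (Suc i) + diag_seq v i - diag_seq v 0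
     + (\<Sum>l\<le>i. (- 1) ^ l * kast_apply n v (int l, int l))"
proof (induction i)
  case 0
  have "v (- 1, 0) = 0" "v (- 1, - 1) = 0" by (auto intro!: outside simp: G_verts_def)
  moreover have "kast_apply n v (0, 0) = v (0, 1) + v (- 1, 0) + v (- 1, - 1) - v (1, 1)"
    using kast_apply_diagonal[of n v 0] outside by simp
  ultimately show ?case by (simp add: near_seq_def diag_seq_def)
next
  case (Suc i)
  have E: "kast_apply n v (1 + int i, 1 + int i) = v (1 + int i, 2 + int i) + v (int i, 1 + int i)
      + v (int i, int i) - v (2 + int i, 2 + int i)"
    using kast_apply_diagonal[of n v "1 + int i"] outside by (simp add: algebra_simps)
  have "(- 1) ^ Suc i * kast_apply n v (1 + int i, 1 + int i) =
      near_seq v (Suc i) - near_seq v i + diag_seq v i - diag_seq v (Suc (Suc i))"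
    unfolding E by (simp add: near_seq_def diag_seq_def algebra_simps)
  with Suc show ?case by simp
qed

lemma diag_seq_beyond: "2 * n < i \<Longrightarrow> diag_seq v i = 0"
  by (simp add: diag_seq_def outside G_verts_def)

text \<open>
  The two parities of \<open>n\<close> differ at the corner: for odd \<open>n\<close> the vertex \<open>(2n, 2n+1)\<close> is absent, while for even
  \<open>n\<close> it is \<open>b\<close>, a leaf attached to \<open>(2n, 2n)\<close>.
\<close>

lemma end_odd: "odd n \<Longrightarrow> near_seq v (2 * n) = 0"
  by (simp add: near_seq_def outside G_verts_def)

lemma end_even:
  assumes "even n"
  shows "diag_seq v (2 * n) = kast_apply n v (b_vertex n)"
proof -
  have b: "b_vertex n = (2 * int n, 2 * int n + 1)" using b_vertex_even[OF assms] by simp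
  have "v (2 * int n, 2 * int n + 2) = 0" "v (2 * int n + 1, 2 * int n + 1) = 0"
    by (auto intro!: outside simp: G_verts_def)
  then show ?thesis unfolding b
    by (subst kast_apply_odd[OF outside]) (auto simp: diag_seq_def algebra_simps)
qed

lemma end_relation:
  "near_seq v (2 * n) = diag_seq v (2 * n) - diag_seq v 0
     + (\<Sum>l\<le>2 * n. (- 1) ^ l * kast_apply n v (int l, int l))"
  using near_seq_eq[of "2 * n"] by (simp add: diag_seq_beyond)

lemma vanishes_if_sequences_vanish:
  assumes "\<And>i. diag_seq v i = 0" "\<And>i. near_seq v i = 0"
  shows "v z = 0"
proof (cases "z \<in> G_verts n")
  case True
  obtain x1 x2 where z: "z = (x1, x2)" by (cases z)
  define x where "x = nat x1"
  have D: "(fdiff ^^ k) (diag_seq v) i = 0" for k i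
    using assms(1) by (induction k arbitrary: i) (auto simp: fdiff_def)
  have N: "(psum ^^ k) (near_seq v) i = 0" for k i
    using assms(2) by (induction k arbitrary: i) (auto simp: psum_def)
  define k where "k = nat ((x2 - x1) div 2)"
  have x: "x1 = int x" "x1 \<le> x2" "x2 \<le> 2 * int n + 1" using True z unfolding x_def by (auto simp: G_verts_def)
  show ?thesis
  proof (cases "even (x2 - x1)")
    case True
    then have "x2 = int x + 2 * int k" unfolding k_def using x by simp
    with vertex_eq_diag[of x k] x D z show ?thesis by simp
  next
    case False
    then have "x2 - x1 = 2 * ((x2 - x1) div 2) + 1" by simp
    then have "x2 = int x + 2 * int k + 1" unfolding k_def using x by simp
    with vertex_eq_near[of x k] x N z show ?thesis by simp
  qed
qed (rule outside)

end

section \<open>Invertibility and signs\<close>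

text \<open>
  For a kernel vector \<open>e i = (c i - c 0 / 2) + (c (i+1) - c 0 / 2)\<close>, which makes \<open>c - c 0 / 2\<close> the
  sequence to smooth. If \<open>c 0 > 0\<close>, its multiple \<open>2 c / c 0 - 1\<close> starts at 1 and ends at \<open>-1\<close> for even \<open>n\<close> and at 1 for odd \<open>n\<close>,
  which are the forbidden boundary signs.
\<close>

lemma kernel_boundary_nonpos:
  assumes n: "1 \<le> n" and "diagonal_source n v"
    and ker: "\<And>x. x \<in> G_verts n \<Longrightarrow> kast_apply n v x = 0"
  shows "diag_seq v 0 \<le> 0"
proof (rule ccontr)
  assume pos: "\<not> diag_seq v 0 \<le> 0"
  interpret diagonal_source n v by fact
  define c e where "c = diag_seq v" and "e = near_seq v"
  have c0: "0 < c 0" using pos by (simp add: c_def)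
  have diag0: "kast_apply n v (int l, int l) = 0" if "l \<le> 2 * n" for l
    using that by (intro ker) (auto simp: G_verts_def)
  have e: "e i = c (Suc i) + c i - c 0" if "i \<le> 2 * n" for i
    using near_seq_eq[OF that] diag0 that by (simp add: c_def e_def)
  have cn: "(- 1) ^ n * (c (2 * n) / (c 0 / 2) - 1) < 0"
  proof (cases "even n")
    case True
    then have "c (2 * n) = 0" using end_even ker[OF b_vertex_in_G_verts] by (simp add: c_def)
    then show ?thesis using True by simp
  next
    case False
    then have "c (2 * n) = c 0"
      using end_odd e[of "2 * n"] by (simp add: c_def e_def diag_seq_beyond)
    then show ?thesis using False c0 by simp
  qed
  show False
  proof (rule boundary_signs_incompatible[of n c e "\<lambda>_. c 0 / 2" "\<lambda>i. c i / (c 0 / 2) - 1"])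
    show "(fdiff ^^ Suc r) c (2 * n - 2 * r) = 0" if "1 \<le> r" "r \<le> n" for r
      unfolding c_def by (rule differences_vanish[OF that])
    show "(psum ^^ (n - m)) e (2 * m + 1) = 0" if "m < n" for m
      unfolding e_def by (rule sums_vanish[OF that])
    show "e i = c 0 / 2 * (c i / (c 0 / 2) - 1 + (c (Suc i) / (c 0 / 2) - 1))" if "i < 2 * n" for i
      using that c0 by (simp add: e field_simps)
    show "c (Suc i) - c i = c 0 / 2 * (c (Suc i) / (c 0 / 2) - 1 - (c i / (c 0 / 2) - 1))" for i
      using c0 by (simp add: field_simps)
  qed (use n c0 cn in simp_all)
qed

lemma kast_kernel_trivial:
  assumes n: "1 \<le> n" and out: "\<And>z. z \<notin> G_verts n \<Longrightarrow> v z = 0"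
    and ker: "\<And>x. x \<in> G_verts n \<Longrightarrow> kast_apply n v x = 0"
  shows "v z = 0"
proof -
  interpret diagonal_source n v using out ker by unfold_locales
  define c e where "c = diag_seq v" and "e = near_seq v"
  have neg: "kast_apply n (\<lambda>z. - v z) x = - kast_apply n v x" for x
    by (simp add: kast_apply_def sum_negf)
  have "diagonal_source n (\<lambda>z. - v z)" using out ker by unfold_locales (auto simp: neg)
  then have "diag_seq (\<lambda>z. - v z) 0 \<le> 0"
    using ker by (intro kernel_boundary_nonpos[OF n]) (auto simp: neg)
  moreover have "diag_seq v 0 \<le> 0"
    using ker by (intro kernel_boundary_nonpos[OF n]) (auto simp: diagonal_source_axioms)
  ultimately have c0: "c 0 = 0" by (simp add: c_def diag_seq_def)
  have diag0: "kast_apply n v (int l, int l) = 0" if "l \<le> 2 * n" for l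
    using that by (intro ker) (auto simp: G_verts_def)
  have e: "e i = c i + c (Suc i)" if "i \<le> 2 * n" for i
    using near_seq_eq[OF that] diag0 that c0 by (simp add: c_def e_def)
  have "c (2 * n) = 0"
    using end_even end_odd ker[OF b_vertex_in_G_verts] e[of "2 * n"] by (cases "even n") (auto simp: c_def e_def diag_seq_beyond)
  then have cn: "c i = 0" if "2 * n \<le> i" for i
    using diag_seq_beyond[of i] that by (cases "i = 2 * n") (auto simp: c_def)
  have c: "c i = 0" for i
  proof (rule vanishes_if_boundary_vanishes[of n c e])
    show "(fdiff ^^ Suc r) c (2 * n - 2 * r) = 0" if "1 \<le> r" "r \<le> n" for r
      unfolding c_def by (rule differences_vanish[OF that])
    show "(psum ^^ (n - m)) e (2 * m + 1) = 0" if "m < n" for m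
      unfolding e_def by (rule sums_vanish[OF that])
  qed (use e c0 cn in auto)
  have "e i = 0" for i
  proof (cases "i \<le> 2 * n")
    case True
    then show ?thesis using e c by simp
  next
    case False
    then show ?thesis by (simp add: e_def near_seq_def outside G_verts_def)
  qed
  then show ?thesis using c by (intro vanishes_if_sequences_vanish) (auto simp: c_def e_def)
qed

lemma kast_apply_inverse_column:
  assumes "is_inverse_on (G_verts n) kast B" "x \<in> G_verts n" "y \<in> G_verts n"
  shows "kast_apply n (\<lambda>z. B z y) x = (if x = y then 1 else 0)"
  using assms by (auto simp: is_inverse_on_def kast_apply_def)

lemma inverse_column_diagonal_source:
  assumes "is_inverse_on (G_verts n) kast B" "y \<in> G_verts n" "fst y = snd y \<or> y = b_vertex n"
  shows "diagonal_source n (\<lambda>z. s * B z y)"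
proof
  show "s * B z y = 0" if "z \<notin> G_verts n" for z
  proof -
    have "B z y = 0" using assms(1) that unfolding is_inverse_on_def by blast
    then show ?thesis by simp
  qed
next
  fix x1 x2 assume x: "(x1, x2) \<in> G_verts n" "x1 \<noteq> x2" "(x1, x2) \<noteq> b_vertex n"
  have "kast_apply n (\<lambda>z. s * B z y) (x1, x2) = s * kast_apply n (\<lambda>z. B z y) (x1, x2)"
    by (simp add: kast_apply_def sum_distrib_left mult.left_commute)
  also have "\<dots> = 0"
    using kast_apply_inverse_column[OF assms(1) x(1) assms(2)] x(2,3) assms(3) by auto
  finally show "kast_apply n (\<lambda>z. s * B z y) (x1, x2) = 0" .
qed

text \<open>
  Let \<open>c\<close> and \<open>e\<close> belong to the column at \<open>(j,j)\<close>, with the sign \<open>(-1)^j\<close>. Antisymmetry gives \<open>c j = 0\<close> and identifies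
  the number in question, by way of the entry at \<open>b\<close>, with \<open>1 - c 0\<close>. The source at \<open>(j,j)\<close> makes \<open>e i\<close>
  equal to \<open>c (i+1) + c i - c 0\<close> before \<open>j\<close> and to \<open>c (i+1) + c i - (c 0 - 1)\<close> from \<open>j\<close> on. If \<open>c 0 > 1\<close>,
  dividing \<open>c\<close> by the positive numbers \<open>c 0 / 2\<close> and \<open>(c 0 - 1) / 2\<close> on the two ranges and
  subtracting 1 gives a single sequence: both rescalings equal \<open>-1\<close> at \<open>j\<close>. It has the forbidden
  boundary signs.
\<close>

lemma inverse_on_diagonal_sign:
  assumes n: "1 \<le> n" and B: "is_inverse_on (G_verts n) kast B" and j: "j \<le> 2 * n"
  shows "0 \<le> diag_seq (\<lambda>z. B z (b_vertex n)) j"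
proof (cases "(int j, int j) = b_vertex n")
  case True
  then show ?thesis
    using inverse_on_antisym[OF finite_G_verts B kast_antisym, of "b_vertex n" "b_vertex n"]
    by (simp add: diag_seq_def)
next
  case False
  define y where "y = (int j, int j)"
  define v where "v = (\<lambda>z. (- 1) ^ j * B z y)"
  have y: "y \<in> G_verts n" "y \<noteq> b_vertex n" using j False by (auto simp: y_def G_verts_def)
  interpret diagonal_source n v
    unfolding v_def by (rule inverse_column_diagonal_source[OF B y(1)]) (simp add: y_def)
  have Kv: "kast_apply n v x = (if x = y then (- 1) ^ j else 0)" if "x \<in> G_verts n" for x
  proof -
    have "kast_apply n v x = (- 1) ^ j * kast_apply n (\<lambda>z. B z y) x"
      by (simp add: v_def kast_apply_def sum_distrib_left mult.left_commute)
    then show ?thesis using kast_apply_inverse_column[OF B that y(1)] by simp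
  qed
  define c e where "c = diag_seq v" and "e = near_seq v"
  have anti: "B x z = - B z x" for x z
    by (rule inverse_on_antisym[OF finite_G_verts B kast_antisym])
  have cj: "c j = 0" using anti[of y y] by (simp add: c_def diag_seq_def v_def y_def)
  have e: "e i = c (Suc i) + c i - c 0 + (if j \<le> i then 1 else 0)" if "i \<le> 2 * n" for i
  proof -
    have "(\<Sum>l\<le>i. (- 1) ^ l * kast_apply n v (int l, int l)) = (\<Sum>l\<le>i. if l = j then 1 else 0)"
      using that by (intro sum.cong) (auto simp: Kv G_verts_def y_def simp flip: power_mult_distrib)
    then show ?thesis using near_seq_eq[OF that] by (simp add: c_def e_def)
  qed
  have even: "c (2 * n) = 0" if "even n"
    using end_even[OF that] Kv[OF b_vertex_in_G_verts] y(2) by (simp add: c_def)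
  have odd: "c (2 * n) = c 0 - 1" if "odd n"
    using end_odd[OF that] e[of "2 * n"] j by (simp add: c_def e_def diag_seq_beyond)
  have vb: "v (b_vertex n) = 1 - c 0"
  proof (cases "even n")
    case True
    then have "v (b_vertex n) = e (2 * n)" by (simp add: b_vertex_even e_def near_seq_def)
    then show ?thesis using e[of "2 * n"] even[OF True] j by (simp add: c_def diag_seq_beyond)
  next
    case False
    then have "v (b_vertex n) = - c (2 * n)" by (simp add: b_vertex_odd c_def diag_seq_def)
    then show ?thesis using odd[OF False] by simp
  qed
  have "diag_seq (\<lambda>z. B z (b_vertex n)) j = v (b_vertex n)"
    using anti[of y "b_vertex n"] by (simp add: diag_seq_def v_def y_def)
  moreover have "c 0 \<le> 1"
  proof (rule ccontr)
    assume "\<not> c 0 \<le> 1"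
    then have c0: "1 < c 0" by simp
    then have "j \<noteq> 0" using cj by (intro notI) simp
    define \<rho> where "\<rho> i = (if i < j then c 0 / 2 else (c 0 - 1) / 2)" for i
    define d where "d i = c i / \<rho> i - 1" for i
    have \<rho>: "0 < \<rho> i" for i using c0 by (simp add: \<rho>_def)
    have d: "\<rho> i * d i = c i - \<rho> i" for i
      using \<rho>[of i] by (simp add: d_def field_simps)
    have dS: "\<rho> i * d (Suc i) = c (Suc i) - \<rho> i" for i
    proof (cases "Suc i = j")
      case True
      then show ?thesis using cj by (simp add: d_def)
    next
      case False
      then have "\<rho> (Suc i) = \<rho> i" by (auto simp: \<rho>_def)
      then show ?thesis using d[of "Suc i"] by simp
    qed
    show False
    proof (rule boundary_signs_incompatible[of n c e \<rho> d])
      show "(fdiff ^^ Suc r) c (2 * n - 2 * r) = 0" if "1 \<le> r" "r \<le> n" for r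
        unfolding c_def by (rule differences_vanish[OF that])
      show "(psum ^^ (n - m)) e (2 * m + 1) = 0" if "m < n" for m
        unfolding e_def by (rule sums_vanish[OF that])
      show "e i = \<rho> i * (d i + d (Suc i))" if "i < 2 * n" for i
        using e[of i] d[of i] dS[of i] that by (simp add: distrib_left) (simp add: \<rho>_def field_simps)
      show "c (Suc i) - c i = \<rho> i * (d (Suc i) - d i)" for i
        using d[of i] dS[of i] by (simp add: right_diff_distrib)
      show "0 < d 0" using \<open>j \<noteq> 0\<close> c0 by (simp add: d_def \<rho>_def)
      show "(- 1) ^ n * d (2 * n) < 0"
      proof (cases "even n")
        case True
        then show ?thesis using even by (simp add: d_def)
      next
        case False
        then have "j \<noteq> 2 * n" using y(2) by (auto simp: y_def b_vertex_odd)
        then have "\<rho> (2 * n) = (c 0 - 1) / 2" using j by (simp add: \<rho>_def)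
        then show ?thesis using False odd c0 by (simp add: d_def)
      qed
    qed (use n \<rho> in auto)
  qed
  ultimately show ?thesis using vb by simp
qed

theorem theorem3p4:
  fixes n :: nat
  assumes "n \<ge> 1"
  shows "(\<Sum>j = 0..2 * n. g_b n j) = (if even n then real n + 1 else real n + 1 / 2)"
proof -
  have "\<exists>B. is_inverse_on (G_verts n) kast B"
  proof (rule ex_inverse_on_if_trivial_kernel[OF finite_G_verts])
    show "v z = 0" if "\<And>x. x \<in> G_verts n \<Longrightarrow> (\<Sum>z\<in>G_verts n. kast x z * v z) = 0"
      "\<And>x. x \<notin> G_verts n \<Longrightarrow> v x = 0" for v z
      by (rule kast_kernel_trivial[OF assms that(2)]) (auto simp: kast_apply_def that(1))
  qed
  then obtain B where B: "is_inverse_on (G_verts n) kast B" ..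
  then have inv: "inverse_on (G_verts n) kast = B" by (rule inverse_on_eqI[OF finite_G_verts])
  define b where "b = b_vertex n"
  define v where "v = (\<lambda>z. B z b)"
  interpret diagonal_source n v
    using inverse_column_diagonal_source[OF B b_vertex_in_G_verts, of 1] by (simp add: v_def b_def)
  define c e where "c = diag_seq v" and "e = near_seq v"
  have Kv: "kast_apply n v x = (if x = b then 1 else 0)" if "x \<in> G_verts n" for x
    using kast_apply_inverse_column[OF B that b_vertex_in_G_verts] by (simp add: v_def b_def)
  have vb: "v b = 0"
    using inverse_on_antisym[OF finite_G_verts B kast_antisym, of b b] by (simp add: v_def)
  have diag: "(\<Sum>l\<le>i. (- 1) ^ l * kast_apply n v (int l, int l)) = (if odd n \<and> i = 2 * n then 1 else 0)"
    if "i \<le> 2 * n" for i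
  proof -
    have "(int l, int l) = b \<longleftrightarrow> odd n \<and> l = 2 * n" for l
      by (cases "even n") (auto simp: b_def b_vertex_even b_vertex_odd)
    then have "(\<Sum>l\<le>i. (- 1) ^ l * kast_apply n v (int l, int l))
        = (\<Sum>l\<le>i. if l = 2 * n then (if odd n then 1 else 0) else 0)"
      using that by (intro sum.cong) (auto simp: Kv G_verts_def)
    then show ?thesis using that by simp
  qed
  have c0: "c 0 = 1" and cn: "c (2 * n) = (if even n then 1 else 0)"
  proof -
    have "c 0 = 1 \<and> c (2 * n) = (if even n then 1 else 0)"
    proof (cases "even n")
      case True
      then have "e (2 * n) = 0" using vb by (simp add: b_def b_vertex_even e_def near_seq_def)
      moreover have "c (2 * n) = 1"
        using end_even[OF True] Kv[OF b_vertex_in_G_verts] by (simp add: c_def b_def)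
      ultimately show ?thesis using end_relation diag[of "2 * n"] True by (simp add: c_def e_def)
    next
      case False
      then have "c (2 * n) = 0" using vb by (simp add: b_def b_vertex_odd c_def diag_seq_def)
      then show ?thesis using end_odd[OF False] end_relation diag[of "2 * n"] False by (simp add: c_def)
    qed
    then show "c 0 = 1" "c (2 * n) = (if even n then 1 else 0)" by auto
  qed
  have "g_b n j = c j" if "j \<le> 2 * n" for j
  proof -
    have "g_b n j = \<bar>c j\<bar>"
      by (simp add: g_b_def inv c_def v_def b_def diag_seq_def abs_mult power_abs)
    then show ?thesis using inverse_on_diagonal_sign[OF assms B that] by (simp add: c_def v_def b_def)
  qed
  then have sum_g: "(\<Sum>j = 0..2 * n. g_b n j) = (\<Sum>j\<le>2 * n. c j)"
    by (intro sum.cong) auto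
  have "0 = psum e (2 * (n - 1) + 1)"
    using sums_vanish[of "n - 1"] assms by (simp add: e_def)
  also have "\<dots> = (\<Sum>i<2 * n. e i)"
    unfolding psum_def using assms by (intro sum.cong) auto
  also have "\<dots> = (\<Sum>i<2 * n. c (Suc i) + c i - 1)"
    using near_seq_eq diag c0 by (intro sum.cong) (auto simp: c_def e_def)
  also have "\<dots> = (\<Sum>i<2 * n. c (Suc i)) + (\<Sum>i<2 * n. c i) - 2 * real n"
    by (simp add: sum.distrib sum_subtractf)
  finally have "(\<Sum>i<2 * n. c (Suc i)) + (\<Sum>i<2 * n. c i) = 2 * real n" by simp
  moreover have "(\<Sum>j\<le>2 * n. c j) = c 0 + (\<Sum>i<2 * n. c (Suc i))"
    unfolding lessThan_Suc_atMost[symmetric] by (rule sum.lessThan_Suc_shift)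
  moreover have "(\<Sum>j\<le>2 * n. c j) = (\<Sum>i<2 * n. c i) + c (2 * n)"
    unfolding lessThan_Suc_atMost[symmetric] by (rule sum.lessThan_Suc)
  ultimately have "2 * (\<Sum>j\<le>2 * n. c j) = c 0 + c (2 * n) + 2 * real n" by linarith
  then show ?thesis unfolding sum_g c0 cn by auto
qed

end
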